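(* Let $a,b\ge1$ be integers. The cube polynomials of the Horadam cubes satisfy, for all $n\ge2$, $$C(\Pi^{a,b}_n,x)=(a+(a-1)x)\,C(\Pi^{a,b}_{n-1},x)+(b+bx)\,C(\Pi^{a,b}_{n-2},x),$$ with initial conditions $C(\Pi^{a,b}_0,x)=1$ and $C(\Pi^{a,b}_1,x)=a+(a-1)x$.
   Context: For integers $a,b\ge1$ and $n\ge 0$, $\mathcal S^{a,b}_n$ is the set of all strings of length $n$ over the alphabet $\{0,1,\dots,a+b-1\}$ in which every letter from $\{a,\dots,a+b-1\}$ appears only immediately after a letter $0$; $\mathcal S^{a,b}_0$ contains only the empty string. The Horadam cube $\Pi^{a,b}_n$ is the simple graph with vertex set $\mathcal S^{a,b}_n$ in which $x_1\cdots x_n$ and $y_1\cdots y_n$ are adjacent if and only if $\sum_{i=1}^n|x_i-y_i|=1$. For a graph $G$, $c_k(G)$ is the number of induced subgraphs of $G$ isomorphic to the $k$-dimensional hypercube $Q_k$, and the cube polynomial is $C(G,x)=\sum_{k\ge0}c_k(G)x^k$. *)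

theory Defs
  imports
    "HOL-Computational_Algebra.Polynomial"
    "Graph_Theory.Graph_Theory"
begin

text \<open>Simple graphs are the loop-free symmetric digraphs without parallel arcs,
  i.e. the locale \<^locale>\<open>graph\<close>: an edge is represented by its two opposite arcs.\<close>

definition horadam_strings :: "nat \<Rightarrow> nat \<Rightarrow> nat \<Rightarrow> nat list set" where
  "horadam_strings a b n =
    {xs. length xs = n \<and> set xs \<subseteq> {0..<a + b} \<and>
         (\<forall>i<n. xs ! i \<in> {a..<a + b} \<longrightarrow> (\<exists>j. i = Suc j \<and> xs ! j = 0))}"

definition horadam_cube :: "nat \<Rightarrow> nat \<Rightarrow> nat \<Rightarrow> (nat list, nat list \<times> nat list) pre_digraph" where
  "horadam_cube a b n = with_proj
    \<lparr> pverts = horadam_strings a b n,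
      parcs = {(xs, ys). xs \<in> horadam_strings a b n \<and> ys \<in> horadam_strings a b n \<and>
                 (\<Sum>i<n. \<bar>int (xs ! i) - int (ys ! i)\<bar>) = 1} \<rparr>"

definition hypercube :: "nat \<Rightarrow> (bool list, bool list \<times> bool list) pre_digraph" where
  "hypercube k = with_proj
    \<lparr> pverts = {xs. length xs = k},
      parcs = {(xs, ys). length xs = k \<and> length ys = k \<and>
                 card {i. i < k \<and> xs ! i \<noteq> ys ! i} = 1} \<rparr>"

definition cube_count :: "('a, 'b) pre_digraph \<Rightarrow> nat \<Rightarrow> nat" where
  "cube_count G k = card {H. induced_subgraph H G \<and> digraph_iso H (hypercube k)}"

text \<open>For a finite graph only finitely many counts are nonzero, so restricting the
  formal sum over all \<open>k\<close> to these makes it a finite sum; see \<open>coeff_cube_polynomial\<close> below.\<close>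

definition cube_polynomial :: "('a, 'b) pre_digraph \<Rightarrow> int poly" where
  "cube_polynomial G = (\<Sum>k | cube_count G k \<noteq> 0. monom (int (cube_count G k)) k)"

lemma finite_horadam_strings: "finite (horadam_strings a b n)"
  by (rule finite_subset[OF _ finite_lists_length_eq[of "{0..<a + b}" n]])
     (auto simp: horadam_strings_def)

lemma graph_horadam_cube: "graph (horadam_cube a b n)"
proof -
  have "finite (arcs (horadam_cube a b n))"
    by (rule finite_subset[of _ "horadam_strings a b n \<times> horadam_strings a b n"])
       (auto simp: horadam_cube_def finite_horadam_strings)
  then show ?thesis
    by unfold_locales
       (auto simp: horadam_cube_def finite_horadam_strings arc_to_ends_def symmetric_def
          abs_minus_commute intro!: symI)
qed

lemma graph_hypercube: "graph (hypercube k)"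
proof -
  have fin: "finite {xs :: bool list. length xs = k}"
    using finite_lists_length_eq[of "UNIV :: bool set" k] by simp
  have verts: "verts (hypercube k) = {xs. length xs = k}"
    and ends: "tail (hypercube k) = fst" "head (hypercube k) = snd"
    by (simp_all add: hypercube_def)
  have arcs: "arcs (hypercube k) =
      {e. length (fst e) = k \<and> length (snd e) = k \<and> card {i. i < k \<and> fst e ! i \<noteq> snd e ! i} = 1}"
    unfolding hypercube_def with_proj_simps pair_pre_digraph.select_convs case_prod_unfold ..
  have arc: "length (fst e) = k \<and> length (snd e) = k \<and> fst e \<noteq> snd e"
    if "e \<in> arcs (hypercube k)" for e
  proof (intro conjI notI)
    assume "fst e = snd e"
    then have "{i. i < k \<and> fst e ! i \<noteq> snd e ! i} = {}" by simp
    moreover have "card {i. i < k \<and> fst e ! i \<noteq> snd e ! i} = 1"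
      using that unfolding arcs by blast
    ultimately show False by (metis card.empty zero_neq_one)
  qed (use that in \<open>unfold arcs, blast+\<close>)
  have "finite (arcs (hypercube k))"
  proof (rule finite_subset)
    show "arcs (hypercube k) \<subseteq> {xs. length xs = k} \<times> {xs. length xs = k}"
    proof
      fix e assume "e \<in> arcs (hypercube k)"
      from arc[OF this] show "e \<in> {xs. length xs = k} \<times> {xs. length xs = k}"
        by (simp add: mem_Times_iff)
    qed
  qed (simp add: fin)
  moreover have "symmetric (hypercube k)"
    unfolding symmetric_conv
  proof
    fix e assume e: "e \<in> arcs (hypercube k)"
    have "{i. i < k \<and> fst e ! i \<noteq> snd e ! i} = {i. i < k \<and> snd e ! i \<noteq> fst e ! i}"
      by blast
    then have "(snd e, fst e) \<in> arcs (hypercube k)"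
      using e unfolding arcs mem_Collect_eq fst_conv snd_conv by (elim conjE) (intro conjI; simp only:)
    then show "\<exists>e'\<in>arcs (hypercube k). tail (hypercube k) e = head (hypercube k) e' \<and>
        head (hypercube k) e = tail (hypercube k) e'"
      by (rule rev_bexI) (simp add: ends)
  qed
  ultimately show ?thesis
    by unfold_locales (use arc in \<open>simp_all add: verts ends fin arc_to_ends_def prod_eq_iff\<close>)
qed

lemma (in fin_digraph) finite_induced_subgraphs: "finite {H. induced_subgraph H G}"
proof -
  have "{H. induced_subgraph H G} \<subseteq>
      (\<lambda>(V, A). \<lparr>verts = V, arcs = A, tail = tail G, head = head G\<rparr>) ` (Pow (verts G) \<times> Pow (arcs G))"
  proof
    fix H :: "('a, 'b) pre_digraph" assume "H \<in> {H. induced_subgraph H G}"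
    then have "H = (\<lambda>(V, A). \<lparr>verts = V, arcs = A, tail = tail G, head = head G\<rparr>) (verts H, arcs H)"
      and "(verts H, arcs H) \<in> Pow (verts G) \<times> Pow (arcs G)"
      by (auto simp: induced_subgraph_def subgraph_def compatible_def)
    then show "H \<in> (\<lambda>(V, A). \<lparr>verts = V, arcs = A, tail = tail G, head = head G\<rparr>) ` (Pow (verts G) \<times> Pow (arcs G))"
      by (rule image_eqI)
  qed
  then show ?thesis by (rule finite_subset) simp
qed

lemma (in fin_digraph) finite_cube_count_support: "finite {k. cube_count G k \<noteq> 0}"
proof (rule finite_subset)
  show "{k. cube_count G k \<noteq> 0} \<subseteq> {..card (verts G)}"
  proof
    fix k assume "k \<in> {k. cube_count G k \<noteq> 0}"
    then obtain H where H: "induced_subgraph H G" "digraph_iso H (hypercube k)"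
      unfolding cube_count_def by (metis (mono_tags, lifting) card.empty empty_Collect_eq mem_Collect_eq)
    have "card (verts (hypercube k)) = card (verts H)"
      using H(2) unfolding digraph_iso_def
      by (auto simp: pre_digraph.digraph_isomorphism_def card_image)
    moreover have "card (verts (hypercube k)) = 2 ^ k"
      using card_lists_length_eq[of "UNIV :: bool set" k] by (simp add: hypercube_def)
    moreover have "card (verts H) \<le> card (verts G)"
      using H(1) by (auto simp: induced_subgraph_def subgraph_def intro: card_mono)
    moreover have "k < 2 ^ k" by simp
    ultimately show "k \<in> {..card (verts G)}" by simp
  qed
qed simp

lemma (in fin_digraph) coeff_cube_polynomial:
  "coeff (cube_polynomial G) k = int (cube_count G k)"
  using finite_cube_count_support
  by (simp add: cube_polynomial_def coeff_sum)

end

theory Submission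
  imports Defs
begin

text \<open>In the grid \<open>\<nat>\<^sup>n\<close> opposite sides of a 4-cycle are parallel, so every injective image of a
  hypercube \<open>Q\<^sub>k\<close> under an edge-preserving map is an axis-parallel box with \<open>k\<close> sides of length 1.
  Hence the cube polynomial enumerates, by dimension, the boxes contained in the set of
  Horadam strings. A box is a word over intervals \<open>{p}\<close> and \<open>{p, p + 1}\<close>, and whether it
  consists of Horadam strings depends only on the upper ends of its intervals: an upper end
  \<open>\<ge> a\<close> must be preceded by the interval \<open>{0}\<close>. Reading such words from the left gives the
  recurrence.\<close>

section \<open>Boxes and distances in the grid\<close>

text \<open>The letter \<open>(p, False)\<close> stands for the interval \<open>{p}\<close> and \<open>(p, True)\<close> for \<open>{p, p + 1}\<close>.\<close>

definition box :: "(nat \<times> bool) list \<Rightarrow> nat list set" where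
  "box w = {xs. list_all2 (\<lambda>(p, d) x. x = p \<or> d \<and> x = Suc p) w xs}"

definition box_dim :: "(nat \<times> bool) list \<Rightarrow> nat" where
  "box_dim w = length (filter snd w)"

definition l1_dist :: "nat list \<Rightarrow> nat list \<Rightarrow> int" where
  "l1_dist xs ys = (\<Sum>i<length xs. \<bar>int (xs ! i) - int (ys ! i)\<bar>)"

definition hamming :: "bool list \<Rightarrow> bool list \<Rightarrow> nat" where
  "hamming bs cs = card {i. i < length bs \<and> bs ! i \<noteq> cs ! i}"

text \<open>Grid edges are oriented upwards and labelled by their coordinate, because both the
  direction and the coordinate are what parallel edges share.\<close>

definition up :: "nat \<Rightarrow> nat list \<Rightarrow> nat list \<Rightarrow> bool" where
  "up i xs ys \<longleftrightarrow> i < length xs \<and> ys = xs[i := Suc (xs ! i)]"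

lemma box_Nil [simp]: "box [] = {[]}"
  by (auto simp: box_def)

lemma Nil_in_box [simp]: "[] \<in> box w \<longleftrightarrow> w = []"
  by (auto simp: box_def)

lemma Cons_in_box_Cons [simp]:
  "x # xs \<in> box ((p, d) # w) \<longleftrightarrow> (x = p \<or> d \<and> x = Suc p) \<and> xs \<in> box w"
  by (auto simp: box_def)

lemma length_box: "xs \<in> box w \<Longrightarrow> length xs = length w"
  by (auto simp: box_def dest: list_all2_lengthD)

lemma box_conv_nth:
  "box w = {xs. length xs = length w \<and>
     (\<forall>i<length w. xs ! i = fst (w ! i) \<or> snd (w ! i) \<and> xs ! i = Suc (fst (w ! i)))}"
  by (auto simp: box_def list_all2_conv_all_nth case_prod_unfold)

lemma lower_corner_in_box: "map fst w \<in> box w"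
  by (simp add: box_conv_nth)

lemma upper_corner_in_box: "map (\<lambda>(p, d). p + of_bool d) w \<in> box w"
  by (auto simp: box_conv_nth case_prod_unfold)

text \<open>The lower and the upper corner of \<open>v\<close> are elements of \<open>box w\<close>;
  comparing them coordinatewise nests the intervals.\<close>

lemma box_mono_nth:
  assumes "box v \<subseteq> box w" and "i < length v"
  shows "fst (w ! i) \<le> fst (v ! i)"
    and "fst (v ! i) + of_bool (snd (v ! i)) \<le> fst (w ! i) + of_bool (snd (w ! i))"
proof -
  have "length v = length w"
    using assms(1) lower_corner_in_box[of v] length_box by fastforce
  moreover have "map fst v \<in> box w" and "map (\<lambda>(p, d). p + of_bool d) v \<in> box w"
    using assms(1) lower_corner_in_box upper_corner_in_box by blast+
  ultimately show "fst (w ! i) \<le> fst (v ! i)"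
    and "fst (v ! i) + of_bool (snd (v ! i)) \<le> fst (w ! i) + of_bool (snd (w ! i))"
    using assms(2) by (fastforce simp: box_conv_nth case_prod_unfold)+
qed

text \<open>Inclusion in both directions forces the interval ends to agree. Counting interval words
  therefore counts boxes.\<close>

lemma inj_box: "inj box"
proof (rule injI)
  fix v w assume eq: "box v = box w"
  then have len: "length v = length w"
    using lower_corner_in_box[of v] length_box by fastforce
  show "v = w"
  proof (rule nth_equalityI[OF len])
    fix i assume "i < length v"
    then show "v ! i = w ! i"
      using box_mono_nth[of v w i] box_mono_nth[of w v i] eq len
      by (cases "v ! i"; cases "w ! i") (auto simp: of_bool_def split: if_splits)
  qed
qed

lemma l1_dist_Nil [simp]: "l1_dist [] ys = 0"
  by (simp add: l1_dist_def)

lemma l1_dist_Cons [simp]: "l1_dist (x # xs) (y # ys) = \<bar>int x - int y\<bar> + l1_dist xs ys"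
  by (simp add: l1_dist_def sum.lessThan_Suc_shift del: sum.lessThan_Suc)

lemma l1_dist_nonneg: "0 \<le> l1_dist xs ys"
  by (simp add: l1_dist_def sum_nonneg)

lemma hamming_Nil [simp]: "hamming [] cs = 0"
  by (simp add: hamming_def)

lemma hamming_conv_sum: "hamming bs cs = (\<Sum>i<length bs. of_bool (bs ! i \<noteq> cs ! i))"
proof -
  have "{i. i < length bs \<and> bs ! i \<noteq> cs ! i} = {..<length bs} \<inter> {i. bs ! i \<noteq> cs ! i}" by auto
  then show ?thesis by (simp add: hamming_def)
qed

lemma hamming_Cons [simp]: "hamming (b # bs) (c # cs) = of_bool (b \<noteq> c) + hamming bs cs"
  by (simp add: hamming_conv_sum sum.lessThan_Suc_shift del: sum.lessThan_Suc)

lemma hamming_self [simp]: "hamming bs bs = 0"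
  by (simp add: hamming_def)

lemma l1_dist_eq_0: "length xs = length ys \<Longrightarrow> l1_dist xs ys = 0 \<Longrightarrow> xs = ys"
proof (induction xs ys rule: list_induct2)
  case (Cons x xs y ys)
  then show ?case using l1_dist_nonneg[of xs ys] by auto
qed simp

text \<open>At the first differing coordinate the whole distance 1 is used up, so the remaining
  tails are at distance 0 and coincide.\<close>

lemma l1_dist_eq_1:
  "length xs = length ys \<Longrightarrow> l1_dist xs ys = 1 \<Longrightarrow> \<exists>i. up i xs ys \<or> up i ys xs"
proof (induction xs ys rule: list_induct2)
  case (Cons x xs y ys)
  show ?case
  proof (cases "x = y")
    case True
    then obtain i where "up i xs ys \<or> up i ys xs" using Cons by auto
    then have "up (Suc i) (x # xs) (y # ys) \<or> up (Suc i) (y # ys) (x # xs)"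
      using True by (auto simp: up_def)
    then show ?thesis by blast
  next
    case False
    then have "l1_dist xs ys = 0" and d: "\<bar>int x - int y\<bar> = 1"
      using Cons.prems l1_dist_nonneg[of xs ys] by auto
    then have "xs = ys" using l1_dist_eq_0 Cons.hyps by blast
    then have "up 0 (x # xs) (y # ys) \<or> up 0 (y # ys) (x # xs)"
      using d by (auto simp: up_def)
    then show ?thesis by blast
  qed
qed simp

text \<open>The index \<open>j\<close> may exceed the length, since an update at a valid
  \<open>i\<close> leaves \<open>nth\<close> unchanged at every other index. Coordinates can then be
  compared without range conditions.\<close>

lemma up_iff_nth:
  "up i xs ys \<longleftrightarrow> i < length xs \<and> length ys = length xs \<and> (\<forall>j. ys ! j = xs ! j + of_bool (j = i))"
proof
  assume "up i xs ys"
  then show "i < length xs \<and> length ys = length xs \<and> (\<forall>j. ys ! j = xs ! j + of_bool (j = i))"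
    by (simp add: up_def nth_list_update)
next
  assume "i < length xs \<and> length ys = length xs \<and> (\<forall>j. ys ! j = xs ! j + of_bool (j = i))"
  then show "up i xs ys"
    unfolding up_def by (intro conjI nth_equalityI) (simp_all add: nth_list_update)
qed

lemma up_left_unique: "up i xs zs \<Longrightarrow> up i ys zs \<Longrightarrow> xs = ys"
  unfolding up_iff_nth by (metis add_right_cancel nth_equalityI)

section \<open>Hypercubes in the grid are boxes\<close>

text \<open>Neither of the two neighbouring edges can undo the step at coordinate \<open>i\<close>, so coordinate
  \<open>i\<close> also increases from \<open>x'\<close> to \<open>y'\<close>.\<close>

lemma parallel_edges:
  assumes xy: "up i x y"
    and xx': "\<exists>j. up j x x' \<or> up j x' x" and yy': "\<exists>j. up j y y' \<or> up j y' y"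
    and x'y': "\<exists>j. up j x' y' \<or> up j y' x'" and ne: "x \<noteq> y'" "y \<noteq> x'"
  shows "up i x' y'"
proof -
  obtain j k m where j: "up j x x' \<or> up j x' x" and k: "up k y y' \<or> up k y' y"
    and m: "up m x' y' \<or> up m y' x'"
    using xx' yy' x'y' by blast
  \<comment> \<open>The step up at \<open>i\<close> from \<open>x\<close> ends in \<open>y\<close>,
    and the step up at \<open>i\<close> into \<open>y\<close> starts in \<open>x\<close>; either
    would identify two opposite corners of the 4-cycle.\<close>
  have no: "\<not> up i x x'" using xy ne by (auto simp: up_def)
  have no': "\<not> up i y' y" using xy ne up_left_unique by blast
  have "x' ! i \<le> x ! i"
    using j
  proof
    assume up: "up j x x'"
    then have "j \<noteq> i" using no by blast
    then show ?thesis using up by (simp add: up_def)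
  qed (simp add: up_iff_nth)
  also have "x ! i < y ! i" using xy by (simp add: up_def)
  also have "y ! i \<le> y' ! i"
    using k
  proof
    assume up: "up k y' y"
    then have "k \<noteq> i" using no' by blast
    then show ?thesis using up by (simp add: up_def)
  qed (simp add: up_iff_nth)
  finally have less: "x' ! i < y' ! i" .
  have "\<not> up m y' x'"
  proof
    assume "up m y' x'"
    then have "x' ! i = y' ! i + of_bool (i = m)" unfolding up_iff_nth by blast
    with less show False by simp
  qed
  with m have up: "up m x' y'" by blast
  \<comment> \<open>A unit step at another coordinate would leave coordinate \<open>i\<close>
    unchanged, against \<open>less\<close>.\<close>
  moreover have "m = i"
    using less up by (cases "m = i") (auto simp: up_def)
  ultimately show ?thesis by simp
qed

text \<open>Splitting the enlarged box by the value at \<open>i\<close> gives the old box at the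
  lower end and its translate \<open>B\<close> at the upper end.\<close>

lemma box_extend:
  assumes i: "i < length w" and flat: "\<not> snd (w ! i)"
    and B: "B = (\<lambda>xs. xs[i := Suc (xs ! i)]) ` box w"
  shows "box (w[i := (fst (w ! i), True)]) = box w \<union> B"
proof (intro equalityI subsetI)
  fix xs assume xs: "xs \<in> box (w[i := (fst (w ! i), True)])"
  then have len: "length xs = length w" by (simp add: length_box)
  have off: "xs ! j = fst (w ! j) \<or> snd (w ! j) \<and> xs ! j = Suc (fst (w ! j))"
    if "j < length w" "j \<noteq> i" for j
    using xs that by (auto simp: box_conv_nth nth_list_update)
  have "xs ! i = fst (w ! i) \<or> xs ! i = Suc (fst (w ! i))"
    using xs i by (auto simp: box_conv_nth nth_list_update)
  then show "xs \<in> box w \<union> B"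
  proof
    assume "xs ! i = fst (w ! i)"
    then have "xs \<in> box w" using off len by (auto simp: box_conv_nth)
    then show ?thesis ..
  next
    assume eq: "xs ! i = Suc (fst (w ! i))"
    \<comment> \<open>Lowering coordinate \<open>i\<close> by one gives the preimage of
      \<open>xs\<close> under the translation.\<close>
    have "xs[i := fst (w ! i)] \<in> box w" using off len i by (auto simp: box_conv_nth nth_list_update)
    moreover have "xs = (xs[i := fst (w ! i)])[i := Suc (xs[i := fst (w ! i)] ! i)]"
      using eq len i by (metis list_update_id list_update_overwrite nth_list_update_eq)
    ultimately have "xs \<in> B" unfolding B by (rule rev_image_eqI)
    then show ?thesis ..
  qed
next
  fix xs assume "xs \<in> box w \<union> B"
  then show "xs \<in> box (w[i := (fst (w ! i), True)])"
    using i flat unfolding B by (auto simp: box_conv_nth nth_list_update)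
qed

lemma box_dim_update:
  assumes "i < length w" and "\<not> snd (w ! i)"
  shows "box_dim (w[i := (p, True)]) = Suc (box_dim w)"
proof -
  have "{j. j < length w \<and> snd (w[i := (p, True)] ! j)} = insert i {j. j < length w \<and> snd (w ! j)}"
    using assms by (auto simp: nth_list_update)
  then show ?thesis using assms by (simp add: box_dim_def length_filter_conv_card)
qed

text \<open>The hypercube is connected, so a property passed along edges spreads from the
  all-\<open>False\<close> vertex to every vertex. The induction hypothesis is applied with first
  bit \<open>False\<close>, and one more edge flips that bit.\<close>

lemma hamming_induct [consumes 1, case_names base step]:
  assumes "length bs = k" and "P (replicate k False)"
    and "\<And>bs cs. length bs = k \<Longrightarrow> length cs = k \<Longrightarrow> hamming bs cs = 1 \<Longrightarrow> P bs \<Longrightarrow> P cs"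
  shows "P bs"
  using assms
proof (induction bs arbitrary: k P)
  case (Cons b bs)
  then obtain k' where k: "k = Suc k'" and len: "length bs = k'" by auto
  have "P (False # bs)"
  proof (rule Cons.IH[OF len, of "\<lambda>bs. P (False # bs)"])
    show "P (False # replicate k' False)" using Cons.prems(2) k by simp
    show "P (False # cs)" if "length bs = k'" "length cs = k'" "hamming bs cs = 1" "P (False # bs)" for bs cs
      using Cons.prems(3)[of "False # bs" "False # cs"] that k by simp
  qed
  then show ?case
    using Cons.prems(3)[of "False # bs" "True # bs"] len k by (cases b) simp_all
qed simp

text \<open>Induction on \<open>k\<close>: the first bit splits the cube into two facets. One maps
  onto a box, and since all edges between the facets are parallel, the other maps onto a translate
  of that box by one unit.\<close>

lemma inj_cube_image_is_box:
  assumes "inj_on f {bs. length bs = k}"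
    and "\<And>bs. length bs = k \<Longrightarrow> length (f bs) = n"
    and "\<And>bs cs. length bs = k \<Longrightarrow> length cs = k \<Longrightarrow> hamming bs cs = 1 \<Longrightarrow> l1_dist (f bs) (f cs) = 1"
  shows "\<exists>w. length w = n \<and> box_dim w = k \<and> f ` {bs. length bs = k} = box w"
  using assms
proof (induction k arbitrary: f)
  case 0
  define w where "w = map (\<lambda>p. (p, False)) (f [])"
  have "box w = {f []}"
    by (auto simp: w_def box_conv_nth intro: nth_equalityI)
  moreover have "box_dim w = 0" "length w = n"
    using "0.prems"(2) by (simp_all add: w_def box_dim_def)
  ultimately show ?case by (intro exI[of _ w]) auto
next
  case (Suc k)
  note inj = Suc.prems(1) and len = Suc.prems(2) and edge = Suc.prems(3)
  have adj: "\<exists>i. up i (f bs) (f cs) \<or> up i (f cs) (f bs)"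
    if "length bs = Suc k" "length cs = Suc k" "hamming bs cs = 1" for bs cs
    using that by (intro l1_dist_eq_1 edge) (simp_all add: len)
  have neq: "f bs \<noteq> f cs" if "length bs = Suc k" "length cs = Suc k" "bs \<noteq> cs" for bs cs
    using inj_onD[OF inj] that by blast
  \<comment> \<open>The bit \<open>s\<close> is chosen so that the edge at the
    all-\<open>False\<close> vertex goes up from facet \<open>s\<close> to facet
    \<open>\<not> s\<close>.\<close>
  obtain i s where first: "up i (f (s # replicate k False)) (f ((\<not> s) # replicate k False))"
  proof -
    have "\<exists>i. up i (f (True # replicate k False)) (f (False # replicate k False)) \<or>
        up i (f (False # replicate k False)) (f (True # replicate k False))"
      by (rule adj) simp_all
    then show thesis using that[of _ True] that[of _ False] by auto
  qed
  \<comment> \<open>Adjacent vertices of the facet span a 4-cycle with their two partners, so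
    \<open>parallel_edges\<close> carries the direction \<open>i\<close> across the whole
    facet.\<close>
  have shift: "up i (f (s # bs)) (f ((\<not> s) # bs))" if "length bs = k" for bs
    using that
  proof (induction rule: hamming_induct)
    case base
    show ?case by (rule first)
  next
    case (step bs cs)
    have "bs \<noteq> cs" using step by auto
    with step show ?case
      by (intro parallel_edges[OF step(4)] adj neq) simp_all
  qed
  have "\<exists>w. length w = n \<and> box_dim w = k \<and> (\<lambda>bs. f (s # bs)) ` {bs. length bs = k} = box w"
  proof (rule Suc.IH)
    show "inj_on (\<lambda>bs. f (s # bs)) {bs. length bs = k}"
      by (rule inj_onI, drule inj_onD[OF inj]) simp_all
  qed (simp_all add: len edge)
  then obtain w where w: "length w = n" "box_dim w = k"
    and A: "(\<lambda>bs. f (s # bs)) ` {bs. length bs = k} = box w" by blast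
  define B where "B = (\<lambda>bs. f ((\<not> s) # bs)) ` {bs. length bs = k}"
  have B: "B = (\<lambda>xs. xs[i := Suc (xs ! i)]) ` box w"
    unfolding B_def A[symmetric] image_image using shift by (intro image_cong) (auto simp: up_def)
  have "f (s # bs) \<noteq> f ((\<not> s) # cs)" if "length bs = k" "length cs = k" for bs cs
    using that by (intro neq) simp_all
  then have disj: "box w \<inter> B = {}"
    unfolding B_def A[symmetric] by blast
  have i: "i < length w"
    using first len[of "s # replicate k False"] w by (simp add: up_def)
  \<comment> \<open>If interval \<open>i\<close> already had length 1, the lower corner raised at
    \<open>i\<close> would lie in the images of both facets, contradicting injectivity.\<close>
  have flat: "\<not> snd (w ! i)"
  proof
    assume "snd (w ! i)"
    then have "(map fst w)[i := Suc (map fst w ! i)] \<in> box w"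
      using i by (auto simp: box_conv_nth nth_list_update)
    moreover have "(map fst w)[i := Suc (map fst w ! i)] \<in> B"
      unfolding B by (intro imageI lower_corner_in_box)
    ultimately show False using disj by blast
  qed
  have "{bs. length bs = Suc k} = (#) s ` {bs. length bs = k} \<union> (#) (\<not> s) ` {bs. length bs = k}"
    by (auto simp: length_Suc_conv image_iff)
  then have "f ` {bs. length bs = Suc k} = box w \<union> B"
    by (simp add: image_Un image_image A B_def)
  then show ?case
    using box_extend[OF i flat B] box_dim_update[OF i flat] w by (metis length_list_update)
qed

section \<open>Every box is a hypercube\<close>

text \<open>Witness that boxes are hypercubes: each interval of length 1 consumes one bit, and
  intervals \<open>{p}\<close> consume none.\<close>

fun box_embedding :: "(nat \<times> bool) list \<Rightarrow> bool list \<Rightarrow> nat list" where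
  "box_embedding [] bs = []"
| "box_embedding ((p, False) # w) bs = p # box_embedding w bs"
| "box_embedding ((p, True) # w) bs = (p + of_bool (hd bs)) # box_embedding w (tl bs)"

lemma box_dim_simps [simp]:
  "box_dim [] = 0"
  "box_dim ((p, d) # w) = of_bool d + box_dim w"
  by (simp_all add: box_dim_def)

lemma box_embedding_in_box: "length bs = box_dim w \<Longrightarrow> box_embedding w bs \<in> box w"
proof (induction w arbitrary: bs)
  case (Cons c w)
  obtain p d where c: "c = (p, d)" by (cases c)
  show ?case
    using Cons by (cases d) (auto simp: c length_Suc_conv)
qed simp

lemma box_embedding_image: "box_embedding w ` {bs. length bs = box_dim w} = box w"
proof (intro equalityI subsetI)
  fix xs assume "xs \<in> box w"
  then show "xs \<in> box_embedding w ` {bs. length bs = box_dim w}"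
  proof (induction w arbitrary: xs)
    case (Cons c w)
    obtain p d where c: "c = (p, d)" by (cases c)
    obtain x ys where xs: "xs = x # ys" "x = p \<or> d \<and> x = Suc p" "ys \<in> box w"
      using Cons.prems by (cases xs) (auto simp: c box_def)
    obtain bs where bs: "length bs = box_dim w" "ys = box_embedding w bs"
      using Cons.IH[OF xs(3)] by blast
    show ?case
    proof (cases d)
      case True
      then have "xs = box_embedding (c # w) ((x = Suc p) # bs)"
        using xs bs by (auto simp: c)
      then show ?thesis by (rule image_eqI) (use True bs in \<open>simp add: c\<close>)
    next
      case False
      then have "xs = box_embedding (c # w) bs" using xs bs by (simp add: c)
      then show ?thesis by (rule image_eqI) (use False bs in \<open>simp add: c\<close>)
    qed
  qed simp
qed (auto intro: box_embedding_in_box)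

text \<open>Fixed coordinates contribute nothing, and each interval of length 1 contributes 1
  exactly when its bits differ. Being an isometry, the embedding both preserves and reflects
  adjacency.\<close>

lemma l1_dist_box_embedding:
  "length bs = box_dim w \<Longrightarrow> length cs = box_dim w \<Longrightarrow>
    l1_dist (box_embedding w bs) (box_embedding w cs) = int (hamming bs cs)"
proof (induction w arbitrary: bs cs)
  case (Cons c w)
  obtain p d where c: "c = (p, d)" by (cases c)
  show ?case
  proof (cases d)
    case True
    then obtain x xs y ys where "bs = x # xs" "cs = y # ys" "length xs = box_dim w" "length ys = box_dim w"
      using Cons.prems by (auto simp: c length_Suc_conv)
    then show ?thesis using Cons.IH[of xs ys] True by (simp add: c)
  next
    case False
    then show ?thesis using Cons by (simp add: c)
  qed
qed simp

lemma hamming_eq_0: "length bs = length cs \<Longrightarrow> hamming bs cs = 0 \<Longrightarrow> bs = cs"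
  by (induction bs cs rule: list_induct2) (auto split: if_splits)

text \<open>Injectivity comes from the isometry: equal images are at distance 0, so the bit strings
  are at Hamming distance 0.\<close>

lemma bij_betw_box_embedding:
  "bij_betw (box_embedding w) {bs. length bs = box_dim w} (box w)"
  unfolding bij_betw_def
proof (intro conjI box_embedding_image inj_onI)
  fix bs cs assume "bs \<in> {bs. length bs = box_dim w}" "cs \<in> {bs. length bs = box_dim w}"
    and "box_embedding w bs = box_embedding w cs"
  then have "length bs = length cs" and "int (hamming bs cs) = 0"
    using l1_dist_box_embedding[of bs w cs] by (simp_all add: l1_dist_def)
  then show "bs = cs" using hamming_eq_0 by simp
qed

section \<open>Isomorphisms with hypercubes and the cube counts\<close>

text \<open>On both sides arcs are pairs read by \<open>fst\<close> and \<open>snd\<close>, so the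
  vertex map of an isomorphism forces its arc map to be \<open>map_prod f f\<close>.\<close>

lemma digraph_iso_with_proj_iff:
  assumes "wf_digraph (with_proj R)" and tail: "tail H = fst" and head: "head H = snd"
  shows "digraph_iso (with_proj R) H \<longleftrightarrow>
    (\<exists>f. bij_betw f (pverts R) (verts H) \<and> arcs H = map_prod f f ` parcs R)"
proof
  assume "digraph_iso (with_proj R) H"
  then obtain h where h: "pre_digraph.digraph_isomorphism (with_proj R) h"
    and H: "H = app_iso h (with_proj R)"
    unfolding digraph_iso_def by blast
  have "iso_tail h = fst" "iso_head h = snd"
    using tail head by (simp_all add: H)
  then have "iso_arcs h e = map_prod (iso_verts h) (iso_verts h) e" if "e \<in> parcs R" for e
    using h that by (auto simp: pre_digraph.digraph_isomorphism_def prod_eq_iff)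
  then have "arcs H = map_prod (iso_verts h) (iso_verts h) ` parcs R"
    by (simp add: H)
  moreover have "bij_betw (iso_verts h) (pverts R) (verts H)"
    using h by (simp add: H pre_digraph.digraph_isomorphism_def bij_betw_def)
  ultimately show "\<exists>f. bij_betw f (pverts R) (verts H) \<and> arcs H = map_prod f f ` parcs R"
    by blast
next
  assume "\<exists>f. bij_betw f (pverts R) (verts H) \<and> arcs H = map_prod f f ` parcs R"
  then obtain f where f: "bij_betw f (pverts R) (verts H)" and arcs: "arcs H = map_prod f f ` parcs R"
    by blast
  define h where "h = \<lparr>iso_verts = f, iso_arcs = map_prod f f, iso_head = snd, iso_tail = fst\<rparr>"
  have "parcs R \<subseteq> pverts R \<times> pverts R"
    using wf_digraph.wellformed[OF assms(1)] by auto
  moreover have "inj_on (map_prod f f) (pverts R \<times> pverts R)"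
    using f by (intro map_prod_inj_on) (simp_all add: bij_betw_def)
  \<comment> \<open>Arcs are pairs of vertices, so the arc map inherits injectivity from the vertex
    map.\<close>
  ultimately have "inj_on (map_prod f f) (parcs R)"
    by (rule inj_on_subset[rotated])
  then have "pre_digraph.digraph_isomorphism (with_proj R) h"
    using assms(1) f by (simp add: pre_digraph.digraph_isomorphism_def h_def bij_betw_def)
  moreover have "H = app_iso h (with_proj R)"
    using f by (simp add: app_iso_def h_def bij_betw_def tail head flip: arcs)
  ultimately show "digraph_iso (with_proj R) H"
    unfolding digraph_iso_def by blast
qed

definition horadam_boxes :: "nat \<Rightarrow> nat \<Rightarrow> nat \<Rightarrow> (nat \<times> bool) list set" where
  "horadam_boxes a b n = {w. length w = n \<and> box w \<subseteq> horadam_strings a b n}"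

lemma arcs_hypercube:
  "arcs (hypercube k) = {(bs, cs). length bs = k \<and> length cs = k \<and> hamming bs cs = 1}"
  by (auto simp: hypercube_def hamming_def)

lemma arcs_horadam_cube:
  "arcs (horadam_cube a b n) =
    {(xs, ys). xs \<in> horadam_strings a b n \<and> ys \<in> horadam_strings a b n \<and> l1_dist xs ys = 1}"
  by (auto simp: horadam_cube_def l1_dist_def horadam_strings_def)

text \<open>An isomorphism is an injective edge-preserving map into the grid, so its image is a box;
  conversely \<open>box_embedding\<close> is an isomorphism onto the subgraph induced on a
  box.\<close>

lemma digraph_iso_hypercube_iff:
  assumes H: "induced_subgraph H (horadam_cube a b n)"
  shows "digraph_iso H (hypercube k) \<longleftrightarrow> (\<exists>w. length w = n \<and> box_dim w = k \<and> verts H = box w)"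
proof -
  have wf: "wf_digraph (hypercube k)" "wf_digraph H"
    using graph_hypercube H
    by (auto simp: induced_subgraph_def subgraph_def graph_def digraph_def fin_digraph_def)
  have proj: "tail H = fst" "head H = snd"
    using H by (auto simp: induced_subgraph_def subgraph_def compatible_def horadam_cube_def)
  define R where "R = \<lparr>pverts = verts (hypercube k), parcs = arcs (hypercube k)\<rparr>"
  have R: "hypercube k = with_proj R" "pverts R = {bs. length bs = k}" "parcs R = arcs (hypercube k)"
    by (simp_all add: R_def hypercube_def)
  \<comment> \<open>The isomorphism is reversed so that its source is the hypercube, which
    \<open>R\<close> presents in the \<open>with_proj\<close> form.\<close>
  have "digraph_iso H (hypercube k) \<longleftrightarrow> digraph_iso (hypercube k) H"
    using digraph_iso_swap[OF wf(1), of H] digraph_iso_swap[OF wf(2), of "hypercube k"] by blast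
  also have "\<dots> \<longleftrightarrow>
      (\<exists>f. bij_betw f {bs. length bs = k} (verts H) \<and> arcs H = map_prod f f ` arcs (hypercube k))"
    using digraph_iso_with_proj_iff[OF _ proj, of R] wf(1) unfolding R(2,3) R(1)[symmetric] by blast
  finally have iso: "digraph_iso H (hypercube k) \<longleftrightarrow>
      (\<exists>f. bij_betw f {bs. length bs = k} (verts H) \<and> arcs H = map_prod f f ` arcs (hypercube k))" .
  have vertsH: "verts H \<subseteq> horadam_strings a b n"
    using H by (auto simp: induced_subgraph_def subgraph_def horadam_cube_def)
  \<comment> \<open>Here inducedness enters: every pair of vertices of \<open>H\<close> at distance
    1 is an arc of \<open>H\<close>.\<close>
  have arcsH: "arcs H = {(xs, ys). xs \<in> verts H \<and> ys \<in> verts H \<and> l1_dist xs ys = 1}"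
    using H vertsH unfolding induced_subgraph_def arcs_horadam_cube
    by (auto simp: horadam_cube_def)
  show ?thesis
    unfolding iso
  proof
    assume "\<exists>f. bij_betw f {bs. length bs = k} (verts H) \<and> arcs H = map_prod f f ` arcs (hypercube k)"
    then obtain f where f: "bij_betw f {bs. length bs = k} (verts H)"
      and arcs: "arcs H = map_prod f f ` arcs (hypercube k)" by blast
    have "\<exists>w. length w = n \<and> box_dim w = k \<and> f ` {bs. length bs = k} = box w"
    proof (rule inj_cube_image_is_box)
      show "inj_on f {bs. length bs = k}" using f by (simp add: bij_betw_def)
      show "length (f bs) = n" if "length bs = k" for bs
        using bij_betwE[OF f] vertsH that by (auto simp: horadam_strings_def)
      show "l1_dist (f bs) (f cs) = 1" if "length bs = k" "length cs = k" "hamming bs cs = 1" for bs cs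
      proof -
        have "map_prod f f (bs, cs) \<in> arcs H"
          unfolding arcs using that by (intro imageI) (simp add: arcs_hypercube)
        then show ?thesis by (simp add: arcsH)
      qed
    qed
    then show "\<exists>w. length w = n \<and> box_dim w = k \<and> verts H = box w"
      using f by (simp add: bij_betw_def)
  next
    assume "\<exists>w. length w = n \<and> box_dim w = k \<and> verts H = box w"
    then obtain w where w: "box_dim w = k" "verts H = box w" by blast
    have "arcs H = map_prod (box_embedding w) (box_embedding w) ` arcs (hypercube k)"
      unfolding arcsH arcs_hypercube w(2) box_embedding_image[of w, symmetric] w(1)[symmetric]
      using l1_dist_box_embedding[of _ w] by (force simp: image_iff)
    then show "\<exists>f. bij_betw f {bs. length bs = k} (verts H) \<and> arcs H = map_prod f f ` arcs (hypercube k)"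
      using bij_betw_box_embedding[of w] w by auto
  qed
qed

text \<open>An induced subgraph is determined by its vertex set, so inducing on \<open>box w\<close>
  matches the words \<open>w\<close> of dimension \<open>k\<close> with the copies of the
  \<open>k\<close>-cube.\<close>

lemma cube_count_horadam_cube:
  "cube_count (horadam_cube a b n) k = card {w \<in> horadam_boxes a b n. box_dim w = k}"
proof -
  interpret graph "horadam_cube a b n" by (rule graph_horadam_cube)
  let ?ind = "\<lambda>w. horadam_cube a b n \<restriction> box w"
  have verts: "verts (horadam_cube a b n) = horadam_strings a b n"
    by (simp add: horadam_cube_def)
  have "{H. induced_subgraph H (horadam_cube a b n) \<and> digraph_iso H (hypercube k)} =
      ?ind ` {w \<in> horadam_boxes a b n. box_dim w = k}"
  proof (intro equalityI subsetI)
    fix H assume "H \<in> {H. induced_subgraph H (horadam_cube a b n) \<and> digraph_iso H (hypercube k)}"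
    then have H: "induced_subgraph H (horadam_cube a b n)" and "digraph_iso H (hypercube k)" by auto
    then obtain w where w: "length w = n" "box_dim w = k" "verts H = box w"
      using digraph_iso_hypercube_iff by blast
    then have "H = ?ind w" and "box w \<subseteq> horadam_strings a b n"
      using H verts by (auto simp: induced_subgraph_def subgraph_def compatible_def induce_subgraph_def)
    then show "H \<in> ?ind ` {w \<in> horadam_boxes a b n. box_dim w = k}"
      using w by (auto simp: horadam_boxes_def)
  next
    fix H assume "H \<in> ?ind ` {w \<in> horadam_boxes a b n. box_dim w = k}"
    then obtain w where w: "H = ?ind w" "length w = n" "box w \<subseteq> horadam_strings a b n" "box_dim w = k"
      by (auto simp: horadam_boxes_def)
    then have "induced_subgraph H (horadam_cube a b n)"
      by (simp add: induced_induce verts)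
    moreover from this have "digraph_iso H (hypercube k)"
      using w digraph_iso_hypercube_iff by auto
    ultimately show "H \<in> {H. induced_subgraph H (horadam_cube a b n) \<and> digraph_iso H (hypercube k)}"
      by simp
  qed
  moreover have "inj ?ind"
    by (rule injI) (metis induce_subgraph_verts inj_box injD)
  ultimately show ?thesis
    unfolding cube_count_def by (simp add: card_image inj_on_subset)
qed

section \<open>Counting boxes of Horadam strings\<close>

text \<open>Here \<open>z\<close> is the letter preceding the string; a string with no predecessor behaves as if
  it were preceded by a nonzero letter, for which \<open>Suc 0\<close> is used throughout.\<close>

fun admissible :: "nat \<Rightarrow> nat \<Rightarrow> nat \<Rightarrow> nat list \<Rightarrow> bool" where
  "admissible a b z [] = True"
| "admissible a b z (x # xs) \<longleftrightarrow> x < a + b \<and> (a \<le> x \<longrightarrow> z = 0) \<and> admissible a b x xs"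

text \<open>The predecessor enters only through the test \<open>z = 0\<close>, so two states,
  \<open>0\<close> and \<open>Suc 0\<close>, suffice for the recurrence.\<close>

lemma admissible_nonzero: "z \<noteq> 0 \<Longrightarrow> admissible a b z xs \<longleftrightarrow> admissible a b (Suc 0) xs"
  by (cases xs) auto

lemma admissible_0: "admissible a b z xs \<Longrightarrow> admissible a b 0 xs"
  by (cases xs) auto

text \<open>Prepending \<open>z\<close> shifts indices by one, so \<open>(z # xs) ! i\<close> is the
  predecessor of \<open>xs ! i\<close>.\<close>

lemma admissible_conv_nth:
  "admissible a b z xs \<longleftrightarrow> set xs \<subseteq> {0..<a + b} \<and> (\<forall>i<length xs. a \<le> xs ! i \<longrightarrow> (z # xs) ! i = 0)"
  by (induction xs arbitrary: z) (auto simp: All_less_Suc2)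

text \<open>The virtual predecessor \<open>Suc 0\<close> is nonzero and so excludes letters
  \<open>\<ge> a\<close> from the first position.\<close>

lemma horadam_strings_conv_admissible:
  "horadam_strings a b n = {xs. length xs = n \<and> admissible a b (Suc 0) xs}"
proof -
  have "(\<exists>j. i = Suc j \<and> xs ! j = 0) \<longleftrightarrow> (Suc 0 # xs) ! i = 0" for i and xs :: "nat list"
    by (cases i) auto
  moreover have "xs ! i < a + b" if "set xs \<subseteq> {0..<a + b}" "i < length xs" for xs i
    using that nth_mem by fastforce
  ultimately show ?thesis
    unfolding horadam_strings_def admissible_conv_nth by auto
qed

definition admissible_boxes :: "nat \<Rightarrow> nat \<Rightarrow> nat \<Rightarrow> nat \<Rightarrow> (nat \<times> bool) list set" where
  "admissible_boxes a b z n = {w. length w = n \<and> (\<forall>xs\<in>box w. admissible a b z xs)}"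

lemma horadam_boxes_conv_admissible: "horadam_boxes a b n = admissible_boxes a b (Suc 0) n"
  by (auto simp: horadam_boxes_def admissible_boxes_def horadam_strings_conv_admissible length_box)

lemma admissible_boxes_nonzero: "z \<noteq> 0 \<Longrightarrow> admissible_boxes a b z n = admissible_boxes a b (Suc 0) n"
  unfolding admissible_boxes_def using admissible_nonzero by blast

lemma admissible_boxes_0: "admissible_boxes a b z 0 = {[]}"
  by (auto simp: admissible_boxes_def)

text \<open>The upper end imposes the strongest conditions: it is the largest letter, and for
  \<open>d = True\<close> it is nonzero, which is the stricter predecessor for the tail.\<close>

lemma Cons_in_admissible_boxes:
  "(p, d) # w \<in> admissible_boxes a b z (Suc n) \<longleftrightarrow>
    p + of_bool d < a + b \<and> (a \<le> p + of_bool d \<longrightarrow> z = 0) \<and> w \<in> admissible_boxes a b (p + of_bool d) n"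
proof -
  have "(\<forall>xs\<in>box ((p, d) # w). admissible a b z xs) \<longleftrightarrow>
      (\<forall>x. x = p \<or> d \<and> x = Suc p \<longrightarrow> (\<forall>xs\<in>box w. admissible a b z (x # xs)))"
    (is "?L \<longleftrightarrow> ?R")
  proof
    assume ?L
    then show ?R by (meson Cons_in_box_Cons)
  next
    assume R: ?R
    show ?L
    proof
      fix xs assume "xs \<in> box ((p, d) # w)"
      then show "admissible a b z xs" using R by (cases xs) auto
    qed
  qed
  \<comment> \<open>An element of \<open>box w\<close> is required to extract the conditions on the
    first letter from the quantifier over strings.\<close>
  moreover have "box w \<noteq> {}" using lower_corner_in_box by blast
  moreover have "admissible a b p xs" if "admissible a b (Suc p) xs" for xs
    using that admissible_nonzero[of p] admissible_nonzero[of "Suc p"] admissible_0 by (cases "p = 0") auto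
  ultimately show ?thesis
    by (cases d) (auto simp: admissible_boxes_def)
qed

lemma finite_admissible_boxes: "finite (admissible_boxes a b z n)"
proof (rule finite_subset)
  show "admissible_boxes a b z n \<subseteq> {w. set w \<subseteq> {..<a + b} \<times> UNIV \<and> length w = n}"
  proof
    fix w assume "w \<in> admissible_boxes a b z n"
    then have "length w = n" "admissible a b z (map fst w)"
      using lower_corner_in_box by (auto simp: admissible_boxes_def)
    then show "w \<in> {w. set w \<subseteq> {..<a + b} \<times> UNIV \<and> length w = n}"
      by (auto simp: admissible_conv_nth)
  qed
qed (simp add: finite_lists_length_eq)

section \<open>Generating polynomials and the recurrence\<close>

text \<open>Boxes are enumerated by dimension. State \<open>Suc 0\<close> gives the cube polynomial;
  state \<open>0\<close> gives the auxiliary polynomial for what may follow the interval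
  \<open>{0}\<close>.\<close>

definition box_poly :: "nat \<Rightarrow> nat \<Rightarrow> nat \<Rightarrow> nat \<Rightarrow> int poly" where
  "box_poly a b z n = (\<Sum>w\<in>admissible_boxes a b z n. monom 1 (box_dim w))"

lemma cube_polynomial_horadam_cube: "cube_polynomial (horadam_cube a b n) = box_poly a b (Suc 0) n"
proof (rule poly_eqI)
  fix k
  interpret graph "horadam_cube a b n" by (rule graph_horadam_cube)
  have "coeff (box_poly a b (Suc 0) n) k = (\<Sum>w\<in>horadam_boxes a b n. of_bool (box_dim w = k))"
    by (simp add: box_poly_def coeff_sum horadam_boxes_conv_admissible of_bool_def)
  also have "\<dots> = int (card {w \<in> horadam_boxes a b n. box_dim w = k})"
    using finite_admissible_boxes by (simp add: horadam_boxes_conv_admissible Int_def)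
  finally show "coeff (cube_polynomial (horadam_cube a b n)) k = coeff (box_poly a b (Suc 0) n) k"
    by (simp add: coeff_cube_polynomial cube_count_horadam_cube)
qed

lemma box_poly_0: "box_poly a b z 0 = 1"
  by (simp add: box_poly_def admissible_boxes_0)

lemma box_poly_nonzero: "z \<noteq> 0 \<Longrightarrow> box_poly a b z n = box_poly a b (Suc 0) n"
  unfolding box_poly_def by (drule admissible_boxes_nonzero) (rule sum.cong, simp_all only:)

text \<open>The first interval has upper end \<open>m \<le> N\<close>; for \<open>m > 0\<close> it may have length 0 or 1, which
  gives the factor \<open>1 + x\<close>, while \<open>m = 0\<close> only allows \<open>{0}\<close>.\<close>

lemma box_poly_Suc:
  assumes "\<And>m. m < Suc N \<longleftrightarrow> m < a + b \<and> (a \<le> m \<longrightarrow> z = 0)"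
  shows "box_poly a b z (Suc n) = box_poly a b 0 n + of_nat N * [:1, 1:] * box_poly a b (Suc 0) n"
proof -
  let ?A = "\<lambda>m. admissible_boxes a b m n"
  \<comment> \<open>In \<open>?S\<close> the index is the single point \<open>m \<le> N\<close>; in
    \<open>?T\<close> it is the lower end \<open>m < N\<close>, so the tail there follows the upper
    end \<open>Suc m\<close>.\<close>
  let ?S = "SIGMA m:{..<Suc N}. ?A m" and ?T = "SIGMA m:{..<N}. ?A (Suc m)"
  let ?f = "\<lambda>(m, w). (m, False) # w" and ?g = "\<lambda>(m, w). (m, True) # w"
  have split: "admissible_boxes a b z (Suc n) = ?f ` ?S \<union> ?g ` ?T"
  proof (intro equalityI subsetI)
    fix w assume w: "w \<in> admissible_boxes a b z (Suc n)"
    then have "length w = Suc n" by (simp add: admissible_boxes_def)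
    then obtain p d v where "w = (p, d) # v" by (cases w) auto
    then show "w \<in> ?f ` ?S \<union> ?g ` ?T"
      using w assms[of "p + of_bool d"] by (cases d) (auto simp: Cons_in_admissible_boxes)
  next
    fix w assume "w \<in> ?f ` ?S \<union> ?g ` ?T"
    then obtain m v where "w = (m, False) # v \<and> m < Suc N \<and> v \<in> ?A m \<or>
        w = (m, True) # v \<and> Suc m < Suc N \<and> v \<in> ?A (Suc m)"
      by auto
    then show "w \<in> admissible_boxes a b z (Suc n)"
      unfolding assms by (auto simp: Cons_in_admissible_boxes)
  qed
  have "box_poly a b z (Suc n) = (\<Sum>w\<in>?f ` ?S. monom 1 (box_dim w)) + (\<Sum>w\<in>?g ` ?T. monom 1 (box_dim w))"
    unfolding box_poly_def split
    by (rule sum.union_disjoint) (auto intro!: finite_imageI finite_SigmaI finite_admissible_boxes)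
  also have "(\<Sum>w\<in>?f ` ?S. monom (1::int) (box_dim w)) = (\<Sum>m<Suc N. box_poly a b m n)"
    by (subst sum.reindex) (auto simp: inj_on_def box_poly_def finite_admissible_boxes case_prod_unfold
        sum.Sigma simp del: sum.lessThan_Suc)
  also have "\<dots> = box_poly a b 0 n + (\<Sum>m<N. box_poly a b (Suc m) n)"
    by (simp add: sum.lessThan_Suc_shift del: sum.lessThan_Suc)
  also have "(\<Sum>m<N. box_poly a b (Suc m) n) = (\<Sum>m<N. box_poly a b (Suc 0) n)"
    by (intro sum.cong refl box_poly_nonzero) simp
  \<comment> \<open>A first interval of length 1 adds one to the dimension, hence the factor
    \<open>monom 1 1\<close>.\<close>
  also have "(\<Sum>w\<in>?g ` ?T. monom (1::int) (box_dim w)) = (\<Sum>m<N. monom 1 1 * box_poly a b (Suc m) n)"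
    by (subst sum.reindex) (auto simp: inj_on_def box_poly_def finite_admissible_boxes case_prod_unfold
        sum.Sigma sum_distrib_left mult_monom)
  also have "\<dots> = (\<Sum>m<N. monom 1 1 * box_poly a b (Suc 0) n)"
    by (intro sum.cong refl arg_cong[of _ _ "(*) _"] box_poly_nonzero) simp
  finally have "box_poly a b z (Suc n) =
      box_poly a b 0 n + of_nat N * (1 + monom 1 1) * box_poly a b (Suc 0) n"
    by (simp add: algebra_simps)
  also have "1 + monom (1::int) 1 = [:1, 1:]"
    by (simp add: monom_altdef one_pCons)
  finally show ?thesis .
qed

theorem corollary2:
  fixes a b :: nat
  assumes "a \<ge> 1" and "b \<ge> 1"
  shows "(\<forall>n\<ge>2. cube_polynomial (horadam_cube a b n) =
            [:int a, int a - 1:] * cube_polynomial (horadam_cube a b (n - 1)) +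
            [:int b, int b:] * cube_polynomial (horadam_cube a b (n - 2))) \<and>
         cube_polynomial (horadam_cube a b 0) = 1 \<and>
         cube_polynomial (horadam_cube a b 1) = [:int a, int a - 1:]"
proof -
  obtain c where a: "a = Suc c" using assms(1) by (cases a) auto
  define u :: "int poly" where "u = [:1, 1:]"
  define F E where "F = box_poly a b (Suc 0)" and "E = box_poly a b 0"
  \<comment> \<open>Without a preceding 0 the largest upper end is \<open>c = a - 1\<close>; after a
    0, in \<open>E\<close>, it is \<open>c + b = a + b - 1\<close>.\<close>
  have F: "F (Suc n) = E n + of_nat c * u * F n" for n
    unfolding F_def E_def u_def by (rule box_poly_Suc) (auto simp: a)
  have E: "E (Suc n) = E n + of_nat (c + b) * u * F n" for n
    unfolding F_def E_def u_def by (rule box_poly_Suc) (auto simp: a)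
  have init: "F 0 = 1" "E 0 = 1"
    by (simp_all add: F_def E_def box_poly_0)
  have ab: "[:int a, int a - 1:] = 1 + of_nat c * u" "[:int b, int b:] = of_nat b * u"
    by (simp_all add: a u_def of_nat_poly one_pCons)
  have "F n = [:int a, int a - 1:] * F (n - 1) + [:int b, int b:] * F (n - 2)" if "n \<ge> 2" for n
  proof -
    define m where "m = n - 2"
    then have n: "n = Suc (Suc m)" using that by simp
    \<comment> \<open>The recurrences for \<open>E\<close> and \<open>F\<close> differ only by the
      \<open>b\<close> extra upper ends, so subtracting them eliminates \<open>E\<close>.\<close>
    have "E (Suc m) = F (Suc m) + of_nat b * u * F m"
      by (simp add: E F algebra_simps)
    then show ?thesis
      unfolding ab n F[of "Suc m"] by (simp add: distrib_right)
  qed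
  moreover have "F 1 = [:int a, int a - 1:]"
    using F[of 0] unfolding ab by (simp add: init)
  ultimately show ?thesis
    unfolding cube_polynomial_horadam_cube F_def[symmetric] using init by blast
qed

end
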